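(* Let $q=p^m$ with $p$ prime, and let $T,\theta$ be functions such that $G=\{\mathfrak{g}_{a,b,c}\}$ is closed under $\circ$ and some $\theta_{a,b,c}$ is nontrivial. If $q$ is odd, then $r_{A,B}\le1$; if $q$ is even, then $r_{A,B}\le2$.
   Context: $T:\mathbb{F}_q^3\to\mathbb{F}_q$, $\theta:\mathbb{F}_q^3\to\mathrm{Aut}(\mathbb{F}_q)$, $\theta_{a,b,c}=\theta(a,b,c)$. $E(a,b,c,t)$ is the $4\times4$ matrix with rows $(1,0,0,0),(-c,1,0,0),(b-ct,t,1,0),(a,b,c,1)$; $\mathfrak{g}_{a,b,c}=(E(a,b,c,T(a,b,c)),\theta_{a,b,c})$, with product $(A_1,\sigma_1)\circ(A_2,\sigma_2)=(A_1^{\sigma_2}A_2,\sigma_1\sigma_2)$ ($A^\sigma$: $\sigma$ applied entrywise); $G=\{\mathfrak{g}_{a,b,c}:a,b,c\in\mathbb{F}_q\}$ (a point regular group of the Payne derived quadrangle of $W(q)$). $\psi:G\to\mathrm{Aut}(\mathbb{F}_q)$, $\mathfrak{g}_{a,b,c}\mapsto\theta_{a,b,c}$. $G_{A,B}=\{\mathfrak{g}_{a,b,0}:a,b\in\mathbb{F}_q\}$ and $p^{r_{A,B}}$ is the exponent of $\psi(G_{A,B})$. *)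

theory Defs
  imports "HOL-Analysis.Analysis"
begin

text \<open>
  The field with q elements is modelled by a type of sort \<open>{field, finite}\<close>;
  the cardinality of this type is q.
\<close>

definition field_aut :: "('a::field \<Rightarrow> 'a) set" where
  "field_aut = {\<sigma>. bij \<sigma> \<and> \<sigma> 1 = 1 \<and>
     (\<forall>x y. \<sigma> (x + y) = \<sigma> x + \<sigma> y) \<and> (\<forall>x y. \<sigma> (x * y) = \<sigma> x * \<sigma> y)}"

definition E :: "'a::field \<Rightarrow> 'a \<Rightarrow> 'a \<Rightarrow> 'a \<Rightarrow> 'a ^ 4 ^ 4" where
  "E a b c t = vector
    [vector [1, 0, 0, 0],
     vector [- c, 1, 0, 0],
     vector [b - c * t, t, 1, 0],
     vector [a, b, c, 1]]"

lemma vector_4 [simp]: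
  "(vector [x, y, z, w] :: ('a::zero) ^ 4) $ 1 = x"
  "(vector [x, y, z, w] :: ('a::zero) ^ 4) $ 2 = y"
  "(vector [x, y, z, w] :: ('a::zero) ^ 4) $ 3 = z"
  "(vector [x, y, z, w] :: ('a::zero) ^ 4) $ 4 = w"
  unfolding vector_def by simp_all

text \<open>
  Automorphisms are written as exponents, so they compose from left to right:
  \<open>A\<close> raised to \<open>\<sigma>\<^sub>1\<sigma>\<^sub>2\<close> is \<open>A\<close> raised to \<open>\<sigma>\<^sub>1\<close> and then to \<open>\<sigma>\<^sub>2\<close>,
  whence the order in the second component.
\<close>

definition semilin_mult ::
  "('a::field ^ 4 ^ 4) \<times> ('a \<Rightarrow> 'a) \<Rightarrow> ('a ^ 4 ^ 4) \<times> ('a \<Rightarrow> 'a) \<Rightarrow> ('a ^ 4 ^ 4) \<times> ('a \<Rightarrow> 'a)"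
  where
  "semilin_mult g h = (map_matrix (snd h) (fst g) ** fst h, snd h \<circ> snd g)"

definition g_elem ::
  "('a::field \<Rightarrow> 'a \<Rightarrow> 'a \<Rightarrow> 'a) \<Rightarrow> ('a \<Rightarrow> 'a \<Rightarrow> 'a \<Rightarrow> ('a \<Rightarrow> 'a)) \<Rightarrow>
   'a \<Rightarrow> 'a \<Rightarrow> 'a \<Rightarrow> ('a ^ 4 ^ 4) \<times> ('a \<Rightarrow> 'a)" where
  "g_elem T \<theta> a b c = (E a b c (T a b c), \<theta> a b c)"

definition G_set ::
  "('a::field \<Rightarrow> 'a \<Rightarrow> 'a \<Rightarrow> 'a) \<Rightarrow> ('a \<Rightarrow> 'a \<Rightarrow> 'a \<Rightarrow> ('a \<Rightarrow> 'a)) \<Rightarrow>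
   (('a ^ 4 ^ 4) \<times> ('a \<Rightarrow> 'a)) set" where
  "G_set T \<theta> = {g_elem T \<theta> a b c | a b c. True}"

definition G_AB ::
  "('a::field \<Rightarrow> 'a \<Rightarrow> 'a \<Rightarrow> 'a) \<Rightarrow> ('a \<Rightarrow> 'a \<Rightarrow> 'a \<Rightarrow> ('a \<Rightarrow> 'a)) \<Rightarrow>
   (('a ^ 4 ^ 4) \<times> ('a \<Rightarrow> 'a)) set" where
  "G_AB T \<theta> = {g_elem T \<theta> a b 0 | a b. True}"

definition \<psi> :: "('a::field ^ 4 ^ 4) \<times> ('a \<Rightarrow> 'a) \<Rightarrow> ('a \<Rightarrow> 'a)" where
  "\<psi> g = snd g"

lemma \<psi>_g_elem [simp]: "\<psi> (g_elem T \<theta> a b c) = \<theta> a b c"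
  by (simp add: \<psi>_def g_elem_def)

text \<open>The exponent of a group of permutations of a type.\<close>

definition perm_exponent :: "('a \<Rightarrow> 'a) set \<Rightarrow> nat" where
  "perm_exponent S = (LEAST n. n > 0 \<and> (\<forall>\<sigma>\<in>S. \<sigma> ^^ n = id))"

text \<open>
  The description below is meaningful because the set \<open>G_set T \<theta>\<close>, once closed under
  \<open>semilin_mult\<close>, is a group of order \<open>q\<^sup>3\<close>, so its image under \<open>\<psi>\<close> is a \<open>p\<close>-group.
\<close>

definition r_AB ::
  "nat \<Rightarrow> ('a::field \<Rightarrow> 'a \<Rightarrow> 'a \<Rightarrow> 'a) \<Rightarrow> ('a \<Rightarrow> 'a \<Rightarrow> 'a \<Rightarrow> ('a \<Rightarrow> 'a)) \<Rightarrow> nat" where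
  "r_AB p T \<theta> = (THE r. p ^ r = perm_exponent (\<psi> ` G_AB T \<theta>))"

end

theory Submission
  imports Defs "HOL-Number_Theory.Residues"
begin

text \<open>
  On \<open>V = F\<^sub>q\<^sup>2\<close> the subgroup \<open>G_AB\<close> is a twisted translation group
  \<open>v * w = \<theta>\<^sub>w v + w\<close>. Its kernel \<open>K\<close> under \<open>\<psi>\<close> is an invariant additive subgroup whose index is
  the order \<open>p\<^sup>r\<close> of the image, and the image is cyclic, generated by some \<open>\<sigma> = \<theta>\<^sub>g\<close>.
  The \<open>n\<close>-th power of \<open>g\<close> is \<open>(1 + \<sigma> + \<dots> + \<sigma>\<^bsup>n-1\<^esup>) g\<close>, which for \<open>n = p\<^sup>k\<close> equals \<open>N\<^bsup>n-1\<^esup> g\<close> with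
  \<open>N = \<sigma> - 1\<close>. For \<open>n = p\<^bsup>r-1\<^esup>\<close> it lies outside \<open>K\<close>, whereas \<open>N\<^sup>r\<close> vanishes on the
  \<open>r\<close>-dimensional \<open>F\<^sub>p\<close>-space \<open>V/K\<close>, because \<open>N\<close> is nilpotent there. Hence \<open>p\<^bsup>r-1\<^esup> \<le> r\<close>.
\<close>

hide_const (open) UnivPoly.coeff UnivPoly.monom

section \<open>Automorphisms of a finite field\<close>

lemma CHAR_eq_if_card_prime_power:
  assumes "prime p" and "CARD('a::{field, finite}) = p ^ m"
  shows "CHAR('a) = p"
proof -
  have "prime CHAR('a)"
    by (intro prime_CHAR_semidom finite_imp_CHAR_pos) simp
  moreover have "CHAR('a) dvd p ^ m"
    using CHAR_dvd_CARD[where 'a = 'a] assms(2) by simp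
  ultimately show ?thesis
    using assms(1) by (metis prime_dvd_power primes_dvd_imp_eq)
qed

lemma finite_field_power_card_minus_1:
  fixes x :: "'a::{field, finite}"
  assumes "x \<noteq> 0"
  shows "x ^ (CARD('a) - 1) = 1"
proof -
  have "(\<Prod>y\<in>UNIV-{0}. x * y) = (\<Prod>y\<in>UNIV-{0}. y)"
    by (rule prod.reindex_bij_witness[of _ "\<lambda>y. y / x" "\<lambda>y. x * y"]) (use assms in auto)
  then have "x ^ (CARD('a) - 1) * \<Prod>(UNIV-{0}) = 1 * \<Prod>(UNIV-{0})"
    by (simp add: prod.distrib)
  then show ?thesis
    using mult_right_cancel[of "\<Prod>(UNIV-{0::'a})"] by simp
qed

text \<open>The type is repackaged as an algebraic structure \<open>R\<close> with explicit carrier,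
  where the multiplicative group of a finite field is known to be cyclic.\<close>

lemma finite_field_primitive_element:
  obtains \<omega> :: "'a::{field, finite}" where "\<omega> \<noteq> 0" "\<And>x. x \<noteq> 0 \<Longrightarrow> \<exists>i. x = \<omega> ^ i"
proof -
  define R where "R = (\<lparr>carrier = UNIV, monoid.mult = (*), one = 1, ring.zero = 0, add = (+)\<rparr> :: 'a ring)"
  have "\<exists>y. x + y = 0" for x :: 'a
    using add.right_inverse by blast
  moreover have "\<exists>y. x * y = 1" if "x \<noteq> 0" for x :: 'a
    using that right_inverse by blast
  ultimately interpret R: Ring.field R
    unfolding R_def by unfold_locales (auto simp: algebra_simps Units_def)
  have pow: "x [^]\<^bsub>R\<^esub> i = x ^ i" for x :: 'a and i :: nat
    by (induction i) (simp_all add: R_def)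
  have carrier: "carrier (mult_of R) = UNIV - {0}"
    by (simp add: R_def)
  have "finite (carrier R)"
    by (simp add: R_def)
  from R.finite_field_mult_group_has_gen[OF this]
  obtain \<omega> :: 'a where \<omega>: "\<omega> \<in> UNIV - {0}" "UNIV - {0} = {\<omega> ^ i | i::nat. i \<in> UNIV}"
    unfolding carrier pow by (elim bexE)
  have "\<exists>i. x = \<omega> ^ i" if "x \<noteq> 0" for x
  proof -
    have "x \<in> {\<omega> ^ i | i::nat. i \<in> UNIV}"
      using that \<omega>(2) by (metis DiffI UNIV_I singletonD)
    then show ?thesis by simp
  qed
  then show ?thesis
    using that \<omega>(1) by simp
qed

lemma power_CHAR_inject:
  fixes x y :: "'a::{field, finite}"
  assumes "x ^ CHAR('a) = y ^ CHAR('a)"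
  shows "x = y"
proof -
  have p: "prime CHAR('a)"
    by (intro prime_CHAR_semidom finite_imp_CHAR_pos) simp
  have "x ^ CHAR('a) = ((x - y) + y) ^ CHAR('a)"
    by simp
  also have "\<dots> = (x - y) ^ CHAR('a) + y ^ CHAR('a)"
    using p by (rule freshmans_dream) simp
  finally show ?thesis
    using assms p by simp
qed

text \<open>If the exponent exceeds 1, the polynomial identity \<open>(X + 1)\<^sup>k = X\<^sup>k + 1\<close> gives \<open>k = 0\<close> in the
  field, by comparing linear coefficients; then a factor \<open>p\<close> can be split off.\<close>

lemma exponent_of_additive_power:
  assumes "0 < k" "k < CARD('a)" "\<And>y::'a::{field, finite}. (y + 1) ^ k = y ^ k + 1"
  shows "\<exists>i. k = CHAR('a) ^ i"
  using assms
proof (induction k rule: less_induct)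
  case (less k)
  let ?p = "CHAR('a)"
  have p: "prime ?p"
    by (intro prime_CHAR_semidom finite_imp_CHAR_pos) simp
  show ?case
  proof (cases "k = 1")
    case True
    then show ?thesis by (intro exI[of _ 0]) simp
  next
    case False
    have "[:1, 1::'a:] ^ k = monom 1 k + 1"
    \<comment> \<open>Both sides have degree at most k < q and agree at all q points of the field,
      so the pointwise hypothesis becomes a polynomial identity.\<close>
    proof (rule poly_eqI_degree[where A = UNIV])
      show "poly ([:1, 1:] ^ k) x = poly (monom 1 k + 1) x" for x :: 'a
        using less.prems(3)[of x] by (simp add: poly_monom add.commute)
      show "degree ([:1, 1::'a:] ^ k) < CARD('a)"
        using less.prems by (simp add: degree_linear_power)
      show "degree (monom 1 k + 1 :: 'a poly) < CARD('a)"
        using less.prems by (intro le_less_trans[OF degree_add_le_max]) (simp add: degree_monom_eq)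
    qed
    then have "coeff ([:1, 1::'a:] ^ k) 1 = 0"
      using False by simp
    then have "?p dvd k"
      using less.prems(1) by (simp add: coeff_linear_poly_power of_nat_eq_0_iff_char_dvd)
    then obtain l where l: "k = ?p * l" by blast
    have "\<exists>i. l = ?p ^ i"
    proof (rule less.IH)
      show "0 < l" "l < k"
        using less.prems(1) l prime_gt_1_nat[OF p] by auto
      then show "l < CARD('a)"
        using less.prems(2) by simp
      show "(y + 1) ^ l = y ^ l + 1" for y :: 'a
      \<comment> \<open>Frobenius is injective, so the identity for l may be checked after raising
        it to the power p, where it is the one for k.\<close>
      proof (rule power_CHAR_inject)
        have "((y + 1) ^ l) ^ ?p = (y ^ l) ^ ?p + 1 ^ ?p"
          using less.prems(3)[of y] l by (simp add: mult.commute flip: power_mult)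
        then show "((y + 1) ^ l) ^ ?p = (y ^ l + 1) ^ ?p"
          using p by (simp add: freshmans_dream)
      qed
    qed
    then show ?thesis
      using l by (metis power_Suc)
  qed
qed

lemma field_aut_power:
  assumes "\<sigma> \<in> field_aut"
  shows "\<sigma> (x ^ n) = \<sigma> x ^ n"
  using assms by (induction n) (auto simp: field_aut_def)

lemma field_aut_0:
  assumes "\<sigma> \<in> field_aut"
  shows "\<sigma> 0 = 0"
proof -
  have "\<sigma> (0 + 0) = \<sigma> 0 + \<sigma> 0"
    using assms unfolding field_aut_def by blast
  then show ?thesis by (metis add.right_neutral add_left_cancel)
qed

lemma funpow_power:
  fixes x :: "'a::monoid_mult"
  shows "((\<lambda>x. x ^ n) ^^ i) x = x ^ (n ^ i)"
  by (induction i) (simp_all add: mult.commute flip: power_mult)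

text \<open>An automorphism is determined by the image of a primitive element, hence is a power map
  x^k; additivity then forces k to be a power of p.\<close>

lemma field_aut_eq_frobenius_power:
  fixes \<sigma> :: "'a::{field, finite} \<Rightarrow> 'a"
  assumes "\<sigma> \<in> field_aut"
  shows "\<exists>i. \<sigma> = (\<lambda>x. x ^ CHAR('a)) ^^ i"
proof -
  obtain \<omega> :: 'a where \<omega>: "\<omega> \<noteq> 0" "\<And>x. x \<noteq> 0 \<Longrightarrow> \<exists>i. x = \<omega> ^ i"
    by (rule finite_field_primitive_element) blast
  let ?q = "CARD('a)"
  have q: "1 < ?q"
    using card_mono[of "UNIV :: 'a set" "{0, 1}"] by simp
  have "\<sigma> \<omega> \<noteq> 0"
    using assms \<omega>(1) field_aut_0[OF assms] unfolding field_aut_def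
    by (metis (mono_tags, lifting) bij_is_inj injD mem_Collect_eq)
  then obtain j where j: "\<sigma> \<omega> = \<omega> ^ j"
    using \<omega>(2) by blast
  \<comment> \<open>The residue 0 is replaced by q - 1, so that 0^k = 0 and still k < q.\<close>
  define k where "k = (if j mod (?q - 1) = 0 then ?q - 1 else j mod (?q - 1))"
  have k: "0 < k" "k < ?q"
    using q mod_less_divisor[of "?q - 1" j] unfolding k_def by (auto simp del: mod_less_divisor)
  have mod: "\<omega> ^ j = \<omega> ^ (j mod (?q - 1))"
  proof -
    have "\<omega> ^ j = \<omega> ^ ((?q - 1) * (j div (?q - 1)) + j mod (?q - 1))"
      by simp
    also have "\<dots> = \<omega> ^ (j mod (?q - 1))"
      unfolding power_add power_mult finite_field_power_card_minus_1[OF \<omega>(1)] by simp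
    finally show ?thesis .
  qed
  have "\<sigma> \<omega> = \<omega> ^ k"
    using j mod finite_field_power_card_minus_1[OF \<omega>(1)] by (auto simp: k_def)
  have \<sigma>: "\<sigma> x = x ^ k" for x
  proof (cases "x = 0")
    case True
    then show ?thesis using k field_aut_0[OF assms] by simp
  next
    case False
    then obtain i where "x = \<omega> ^ i"
      using \<omega>(2) by blast
    then show ?thesis
      using \<open>\<sigma> \<omega> = \<omega> ^ k\<close> by (simp add: field_aut_power[OF assms] power_commutes mult.commute flip: power_mult)
  qed
  have "(y + 1) ^ k = y ^ k + 1" for y :: 'a
    using assms unfolding field_aut_def by (metis (mono_tags, lifting) \<sigma> mem_Collect_eq)
  from exponent_of_additive_power[OF k this]
  obtain i where i: "k = CHAR('a) ^ i" by blast
  have "\<sigma> = (\<lambda>x. x ^ CHAR('a)) ^^ i"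
    using \<sigma> i by (auto simp: funpow_power)
  then show ?thesis ..
qed

section \<open>Cyclic groups of iterates and their orders\<close>

lemma cyclic_if_subset_funpow_range:
  fixes f :: "'a \<Rightarrow> 'a"
  assumes "A \<subseteq> range (\<lambda>i. f ^^ i)" and "id \<in> A" and "\<And>\<sigma> \<tau>. \<sigma> \<in> A \<Longrightarrow> \<tau> \<in> A \<Longrightarrow> \<sigma> \<circ> \<tau> \<in> A"
    and "m > 0" and "f ^^ m = id"
  obtains \<sigma> where "A = range (\<lambda>i. \<sigma> ^^ i)"
proof -
  define d where "d = (LEAST i. i > 0 \<and> f ^^ i \<in> A)"
  have d: "d > 0" "f ^^ d \<in> A"
    using LeastI[of "\<lambda>i. i > 0 \<and> f ^^ i \<in> A" m] assms(2,4,5) by (auto simp: d_def)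
  have d_le: "d \<le> i" if "i > 0" "f ^^ i \<in> A" for i
    unfolding d_def using that by (intro Least_le) simp
  have pow: "(f ^^ d) ^^ i \<in> A" for i
    using assms(2) d(2) by (induction i) (auto intro: assms(3))
  have "\<tau> \<in> range (\<lambda>i. (f ^^ d) ^^ i)" if \<tau>: "\<tau> \<in> A" for \<tau>
  proof -
    obtain i where i: "\<tau> = f ^^ i"
      using \<tau> assms(1) by blast
    define s where "s = i div d"
    define t where "t = i mod d"
    have i_eq: "i = s * d + t"
      by (simp add: s_def t_def)
    \<comment> \<open>Inverses are expressed as positive powers: since \<open>f ^^ m = id\<close>,
      composing with \<open>f ^^ (s * d * (m - 1))\<close> cancels \<open>f ^^ (s * d)\<close> and
      leaves the remainder \<open>f ^^ t\<close>.\<close>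
    have "s * d + s * d * (m - 1) = m * (s * d)"
      using assms(4) by (cases m) (simp_all add: algebra_simps)
    then have "f ^^ (i + s * d * (m - 1)) = f ^^ t \<circ> f ^^ (m * (s * d))"
      unfolding i_eq by (metis add.assoc add.commute funpow_add)
    also have "\<dots> = f ^^ t"
      using assms(5) by (simp flip: funpow_mult)
    finally have "f ^^ t = f ^^ i \<circ> (f ^^ d) ^^ (s * (m - 1))"
      by (simp add: funpow_add funpow_mult mult_ac)
    then have "f ^^ t \<in> A"
      using assms(3) \<tau> pow i by metis
    moreover have "t < d"
      using d(1) by (simp add: t_def)
    ultimately have "t = 0"
      using d_le by fastforce
    then have "\<tau> = (f ^^ d) ^^ s"
      by (simp add: i i_eq funpow_mult mult.commute)
    then show ?thesis by blast
  qed
  then have "A = range (\<lambda>i. (f ^^ d) ^^ i)"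
    using pow by auto
  then show ?thesis ..
qed


text \<open>Links the size of a cyclic group, which counting yields, to the order of its generator:
  the powers below the least period d are distinct and exhaust the range.\<close>

lemma order_eq_card_range_funpow:
  fixes f :: "'a \<Rightarrow> 'a"
  assumes "m > 0" and "f ^^ m = id"
  defines "n \<equiv> card (range (\<lambda>i. f ^^ i))"
  shows "f ^^ n = id" and "\<And>i. 0 < i \<Longrightarrow> i < n \<Longrightarrow> f ^^ i \<noteq> id"
proof -
  define d where "d = (LEAST i. i > 0 \<and> f ^^ i = id)"
  have d: "d > 0" "f ^^ d = id"
    using LeastI[of "\<lambda>i. i > 0 \<and> f ^^ i = id" m] assms(1,2) by (auto simp: d_def)
  have d_min: "f ^^ i \<noteq> id" if "0 < i" "i < d" for i
    using that not_less_Least[of i "\<lambda>i. i > 0 \<and> f ^^ i = id"] by (auto simp: d_def)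
  have mod: "f ^^ i = f ^^ (i mod d)" for i
    using d(2) by (intro ext) (simp add: funpow_mod_eq)
  have "range (\<lambda>i. f ^^ i) = (\<lambda>i. f ^^ i) ` {..<d}"
  proof (intro equalityI subsetI)
    fix \<tau> assume "\<tau> \<in> range (\<lambda>i. f ^^ i)"
    then obtain i where "\<tau> = f ^^ i" by blast
    then have "\<tau> = f ^^ (i mod d)"
      using mod by simp
    then show "\<tau> \<in> (\<lambda>i. f ^^ i) ` {..<d}"
      using d(1) by simp
  qed auto
  moreover have "inj_on (\<lambda>i. f ^^ i) {..<d}"
  proof (rule linorder_inj_onI)
    fix i j :: nat assume ij: "i < j" "i \<in> {..<d}" "j \<in> {..<d}"
    show "f ^^ i \<noteq> f ^^ j"
    proof
      assume eq: "f ^^ i = f ^^ j"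
      have "f ^^ (j - i) = f ^^ (j - i) \<circ> f ^^ d"
        using d(2) by simp
      also have "\<dots> = f ^^ (d - i) \<circ> f ^^ j"
        unfolding funpow_add[symmetric] using ij by (intro arg_cong[of _ _ "\<lambda>i. f ^^ i"]) auto
      also have "\<dots> = f ^^ (d - i) \<circ> f ^^ i"
        using eq by simp
      also have "\<dots> = f ^^ d"
        unfolding funpow_add[symmetric] using ij by (intro arg_cong[of _ _ "\<lambda>i. f ^^ i"]) auto
      finally show False
        using d_min[of "j - i"] d(2) ij by (simp add: less_imp_diff_less)
    qed
  qed auto
  ultimately have "n = d"
    by (simp add: n_def card_image)
  then show "f ^^ n = id" "\<And>i. 0 < i \<Longrightarrow> i < n \<Longrightarrow> f ^^ i \<noteq> id"
    using d d_min by auto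
qed

section \<open>Iterates of an additive map in characteristic p\<close>

lemma card_additive_subgroup_dvd:
  fixes W :: "'v::{ab_group_add, finite} set"
  assumes "0 \<in> W" and "\<And>x y. x \<in> W \<Longrightarrow> y \<in> W \<Longrightarrow> x - y \<in> W"
  shows "card W dvd CARD('v)"
proof -
  define G where "G = (\<lparr>carrier = UNIV, monoid.mult = (+), one = 0\<rparr> :: 'v monoid)"
  have "\<exists>y. y + x = 0" for x :: 'v
    using add.left_inverse by blast
  then interpret G: group G
    by (intro groupI) (auto simp: G_def add.assoc)
  have inv: "inv\<^bsub>G\<^esub> x = - x" for x
    by (rule G.inv_equality) (auto simp: G_def)
  have minus: "- y \<in> W" if "y \<in> W" for y
    using assms(2)[OF assms(1) that] by simp
  have "subgroup W G"
  proof (rule G.subgroupI)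
    show "x \<otimes>\<^bsub>G\<^esub> y \<in> W" if "x \<in> W" "y \<in> W" for x y
      using assms(2)[OF that(1) minus[OF that(2)]] by (simp add: G_def)
  qed (use assms(1) minus inv in \<open>auto simp: G_def\<close>)
  from G.lagrange[OF this] show ?thesis
    by (metis G_def dvd_triv_right order_def partial_object.select_convs(1))
qed

text \<open>The preimages of \<open>K\<close> under the powers of \<open>N\<close> form a chain of subgroups which grows
  strictly as long as some element is moved into \<open>K\<close> only by the next power.\<close>

lemma card_ge_if_funpow_notin:
  fixes K :: "'v::{ab_group_add, finite} set"
  assumes p: "prime p" and card: "CARD('v) = p ^ n"
    and K: "0 \<in> K" "\<And>x y. x \<in> K \<Longrightarrow> y \<in> K \<Longrightarrow> x - y \<in> K"
    and N_diff: "\<And>x y. N (x - y) = N x - N y" and N_K: "\<And>x. x \<in> K \<Longrightarrow> N x \<in> K"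
    and g: "(N ^^ D) g \<notin> K" "(N ^^ M) g \<in> K"
  shows "card K * p ^ Suc D \<le> CARD('v)"
proof -
  \<comment> \<open>The chain \<open>W i\<close> is shown to grow strictly up to this step, and D
    lies below it.\<close>
  define L where "L = (LEAST i. (N ^^ i) g \<in> K)"
  have L_in: "(N ^^ L) g \<in> K"
    unfolding L_def by (rule LeastI) (rule g(2))
  have K_le: "(N ^^ j) g \<in> K" if "(N ^^ i) g \<in> K" "i \<le> j" for i j
    using that(2,1) by (induction rule: dec_induct) (auto intro: N_K)
  have "D < L"
    using K_le[OF L_in] g(1) by (meson not_less)
  define W where "W i = {v. (N ^^ i) v \<in> K}" for i
  have Nn_diff: "(N ^^ i) (x - y) = (N ^^ i) x - (N ^^ i) y" for i x y
    by (induction i) (simp_all add: N_diff)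
  have card_W: "\<exists>a. card (W i) = p ^ a" for i
  proof -
    have "(N ^^ i) 0 = 0"
      using Nn_diff[of i 0 0] by simp
    then have "card (W i) dvd CARD('v)"
      using K by (intro card_additive_subgroup_dvd) (auto simp: W_def Nn_diff)
    then show ?thesis
      using divides_primepow_nat[OF p] by (auto simp: card)
  qed
  have "card K * p ^ i \<le> card (W i)" if "i \<le> L" for i
    using that
  proof (induction i)
    case 0
    then show ?case by (simp add: W_def)
  next
    case (Suc i)
    obtain a b where ab: "card (W i) = p ^ a" "card (W (Suc i)) = p ^ b"
      using card_W by metis
    have "W i \<subseteq> W (Suc i)"
      by (auto simp: W_def N_K)
    \<comment> \<open>Witness of strict growth: i + 1 further applications of N reach exponent L, i
      applications stop one short of it.\<close>
    moreover have "(N ^^ (L - Suc i)) g \<in> W (Suc i) - W i"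
    proof -
      have "(N ^^ (Suc i + (L - Suc i))) g \<in> K"
        using Suc.prems L_in by simp
      moreover have "(N ^^ (i + (L - Suc i))) g \<notin> K"
        using Suc.prems not_less_Least[of "i + (L - Suc i)" "\<lambda>i. (N ^^ i) g \<in> K"]
        by (simp add: L_def)
      ultimately show ?thesis
        by (simp only: W_def mem_Collect_eq Diff_iff funpow_add o_apply not_False_eq_True simp_thms)
    qed
    ultimately have "card (W i) < card (W (Suc i))"
      by (intro psubset_card_mono) auto
    then have "a < b"
      using ab prime_gt_1_nat[OF p] by simp
    \<comment> \<open>Both orders are powers of p, so strict growth is growth by a factor of at
      least p.\<close>
    then have "p ^ Suc a \<le> p ^ b"
      using prime_gt_0_nat[OF p] by (intro power_increasing) auto
    then have "card (W i) * p \<le> card (W (Suc i))"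
      using ab by (simp add: mult.commute)
    moreover have "card K * p ^ i * p \<le> card (W i) * p"
      using Suc by (intro mult_right_mono) auto
    ultimately have "card K * p ^ i * p \<le> card (W (Suc i))"
      by (rule order_trans[rotated])
    then show ?case
      by (simp add: mult_ac)
  qed
  from this[of "Suc D"] have "card K * p ^ Suc D \<le> card (W (Suc D))"
    using \<open>D < L\<close> by simp
  also have "\<dots> \<le> CARD('v)"
    by (intro card_mono) auto
  finally show ?thesis .
qed

text \<open>With N = \<open>\<sigma>\<close> - 1, this is the binomial expansion of ((1 + N)^n - 1)
  / N, proved without dividing by N through Pascal's rule.\<close>

lemma sum_funpow_eq_sum_binomial:
  fixes \<sigma> :: "'a::comm_ring_1 \<Rightarrow> 'a"
  assumes add: "\<And>x y. \<sigma> (x + y) = \<sigma> x + \<sigma> y"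
  shows "(\<Sum>i<n. (\<sigma> ^^ i) x) = (\<Sum>j<n. of_nat (n choose Suc j) * ((\<lambda>x. \<sigma> x - x) ^^ j) x)"
proof (induction n)
  case 0
  then show ?case by simp
next
  case (Suc n)
  define N where "N x = \<sigma> x - x" for x
  have zero: "\<sigma> 0 = 0"
    using add[of 0 0] by (metis add.right_neutral add_left_cancel)
  have scale: "N (of_nat c * x) = of_nat c * N x" for c x
  proof -
    have "\<sigma> (of_nat c * x) = of_nat c * \<sigma> x"
      by (induction c) (simp_all add: zero add distrib_right)
    then show ?thesis
      by (simp add: N_def algebra_simps)
  qed
  have N_sum: "N (sum f A) = (\<Sum>a\<in>A. N (f a))" for f :: "nat \<Rightarrow> 'a" and A
    by (induction A rule: infinite_finite_induct) (simp_all add: N_def zero add)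
  have \<sigma>_sum: "\<sigma> (sum f A) = (\<Sum>a\<in>A. \<sigma> (f a))" for f :: "nat \<Rightarrow> 'a" and A
    by (induction A rule: infinite_finite_induct) (simp_all add: zero add)
  have IH: "(\<Sum>i<n. (\<sigma> ^^ i) x) = (\<Sum>j<n. of_nat (n choose Suc j) * (N ^^ j) x)"
    using Suc.IH by (simp add: N_def[abs_def])
  have "(\<Sum>i<Suc n. (\<sigma> ^^ i) x) = x + \<sigma> (\<Sum>i<n. (\<sigma> ^^ i) x)"
    by (subst sum.lessThan_Suc_shift) (simp add: \<sigma>_sum)
  also have "\<dots> = x + N (\<Sum>i<n. (\<sigma> ^^ i) x) + (\<Sum>i<n. (\<sigma> ^^ i) x)"
    by (simp add: N_def)
  also have "\<dots> = x + (\<Sum>j<n. of_nat (n choose Suc j) * (N ^^ Suc j) x)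
      + (\<Sum>j<n. of_nat (n choose Suc j) * (N ^^ j) x)"
    unfolding IH by (simp add: N_sum scale)
  \<comment> \<open>The lone x becomes the term j = 0 after the index shift.\<close>
  also have "x + (\<Sum>j<n. of_nat (n choose Suc j) * (N ^^ Suc j) x)
      = (\<Sum>j<Suc n. of_nat (n choose j) * (N ^^ j) x)"
    by (subst sum.lessThan_Suc_shift) simp
  \<comment> \<open>The new term j = n vanishes; with equal ranges the two sums merge
    termwise.\<close>
  also have "(\<Sum>j<n. of_nat (n choose Suc j) * (N ^^ j) x)
      = (\<Sum>j<Suc n. of_nat (n choose Suc j) * (N ^^ j) x)"
    by (simp add: binomial_eq_0)
  also have "(\<Sum>j<Suc n. of_nat (n choose j) * (N ^^ j) x)
        + (\<Sum>j<Suc n. of_nat (n choose Suc j) * (N ^^ j) x)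
      = (\<Sum>j<Suc n. of_nat (Suc n choose Suc j) * (N ^^ j) x)"
    unfolding sum.distrib[symmetric] by (intro sum.cong) (simp_all add: algebra_simps)
  finally show ?case
    by (simp add: N_def[abs_def])
qed

text \<open>Compare the coefficients of X^j in (X + 1)^n = X^n + 1, where n is a power of the
  characteristic.\<close>

lemma of_nat_prime_power_choose_eq_0:
  assumes "prime CHAR('a::comm_ring_1)" "0 < j" "j < CHAR('a) ^ k"
  shows "(of_nat (CHAR('a) ^ k choose j) :: 'a) = 0"
proof -
  let ?n = "CHAR('a) ^ k"
  have "(monom 1 1 + 1 :: 'a poly) ^ ?n = monom 1 1 ^ ?n + 1 ^ ?n"
    using assms(1) by (intro freshmans_dream'[where n = k]) simp_all
  moreover have "[:1, 1::'a:] = monom 1 1 + 1"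
    by (simp add: monom_altdef one_pCons)
  ultimately have "[:1, 1::'a:] ^ ?n = monom 1 ?n + 1"
    by (simp add: monom_power)
  then have "coeff ([:1, 1::'a:] ^ ?n) j = 0"
    using assms by simp
  then show ?thesis
    using assms by (simp add: coeff_linear_poly_power)
qed

text \<open>In the binomial expansion only the last term, j = n - 1 with coefficient 1, survives
  modulo p.\<close>

lemma sum_funpow_prime_power:
  fixes \<sigma> :: "'a::comm_ring_1 \<Rightarrow> 'a"
  assumes p: "prime CHAR('a)" and add: "\<And>x y. \<sigma> (x + y) = \<sigma> x + \<sigma> y"
  shows "(\<Sum>i<CHAR('a) ^ k. (\<sigma> ^^ i) x) = ((\<lambda>x. \<sigma> x - x) ^^ (CHAR('a) ^ k - 1)) x"
proof -
  let ?n = "CHAR('a) ^ k"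
  have n: "?n > 0"
    using prime_gt_0_nat[OF p] by simp
  have "(\<Sum>i<?n. (\<sigma> ^^ i) x) = (\<Sum>j<?n. of_nat (?n choose Suc j) * ((\<lambda>x. \<sigma> x - x) ^^ j) x)"
    by (rule sum_funpow_eq_sum_binomial) (rule add)
  also have "\<dots> = (\<Sum>j\<in>{?n - 1}. of_nat (?n choose Suc j) * ((\<lambda>x. \<sigma> x - x) ^^ j) x)"
  proof (intro sum.mono_neutral_right ballI)
    fix j assume "j \<in> {..<?n} - {?n - 1}"
    then have "Suc j < ?n" by auto
    then show "of_nat (?n choose Suc j) * ((\<lambda>x. \<sigma> x - x) ^^ j) x = 0"
      using p by (simp add: of_nat_prime_power_choose_eq_0)
  qed (use n in auto)
  finally show ?thesis
    using n by simp
qed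


section \<open>Regular subgroups of the semilinear affine group of the plane\<close>

text \<open>Here \<open>s v\<close> is the automorphism attached to the point v, and
  \<open>mult\<close> says that s respects the twisted product. The case r = 0 is separate because
  \<open>0 - 1 = 0\<close> would turn the bound into 1 <= 0.\<close>

lemma twisted_plane_group_exponent:
  fixes s :: "'a::{field, finite} \<times> 'a \<Rightarrow> 'a \<Rightarrow> 'a"
  assumes p: "prime p" and card: "CARD('a) = p ^ m"
    and aut: "\<And>v. s v \<in> field_aut"
    and mult: "\<And>v w. s w \<circ> s v = s (map_prod (s w) (s w) v + w)"
  shows "\<exists>r. (r = 0 \<or> p ^ (r - 1) \<le> r) \<and> (\<forall>v. s v ^^ (p ^ r) = id)"
proof -
  have CHAR: "CHAR('a) = p"
    using p card by (rule CHAR_eq_if_card_prime_power)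
  have m: "m > 0"
  proof (rule ccontr)
    assume "\<not> m > 0"
    then have "CARD('a) = 1" using card by simp
    then show False
      using card_mono[of "UNIV :: 'a set" "{0, 1}"] by simp
  qed
  define \<phi> where "\<phi> = (\<lambda>x::'a. x ^ CHAR('a))"
  have "x ^ CARD('a) = x" for x :: 'a
    using finite_field_power_card_minus_1[of x] by (cases "x = 0") (simp_all add: power_eq_if)
  then have \<phi>_m: "\<phi> ^^ m = id"
    by (intro ext) (simp add: \<phi>_def funpow_power CHAR flip: card)
  have frob: "\<exists>i. s v = \<phi> ^^ i" for v
    unfolding \<phi>_def by (rule field_aut_eq_frobenius_power) (rule aut)
  have inj: "inj (s v)" and add: "s v (x + y) = s v x + s v y" for v x y
    using aut[of v] by (auto simp: field_aut_def bij_is_inj)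
  have zero: "s v 0 = 0" for v
    by (rule field_aut_0) (rule aut)
  have bij: "bij (s v)" for v
    using aut[of v] by (auto simp: field_aut_def)
  \<comment> \<open>\<open>mult\<close> makes \<open>s 0\<close> idempotent, and it is
    injective.\<close>
  have s_0: "s 0 = id"
    using mult[of 0 0] inj[of 0] by (simp add: fun_eq_iff inj_eq zero zero_prod_def)
  define K where "K = {v. s v = id}"
  define A where "A = range s"
  have A_comp: "\<tau> \<circ> \<rho> \<in> A" if "\<tau> \<in> A" "\<rho> \<in> A" for \<tau> \<rho>
    using that mult unfolding A_def by auto
  have "A \<subseteq> range (\<lambda>i. \<phi> ^^ i)"
    using frob unfolding A_def by blast
  moreover have "id \<in> A"
    unfolding A_def s_0[symmetric] by (rule rangeI)
  \<comment> \<open>The image A lies in the cyclic group generated by Frobenius.\<close>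
  ultimately obtain \<sigma> where A_eq: "A = range (\<lambda>i. \<sigma> ^^ i)"
    using cyclic_if_subset_funpow_range[of A \<phi> m] A_comp m \<phi>_m by metis
  have "\<sigma> \<in> A"
    unfolding A_eq by (rule range_eqI[of _ _ 1]) simp
  then obtain g where g: "s g = \<sigma>"
    unfolding A_def by auto

  have K_0: "0 \<in> K"
    by (simp add: K_def s_0)
  have K_add: "v + w \<in> K" if "v \<in> K" "w \<in> K" for v w
    using that mult[of w v] by (simp add: K_def prod.map_id0)
  have K_minus: "- v \<in> K" if "v \<in> K" for v
    using that mult[of v "- v"] by (simp add: K_def prod.map_id0 s_0)
  have K_diff: "v - w \<in> K" if "v \<in> K" "w \<in> K" for v w
    using K_add[OF that(1) K_minus[OF that(2)]] by simp
  have K_invariant: "map_prod (s w) (s w) k \<in> K" if k: "k \<in> K" for w k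
  proof -
    \<comment> \<open>z is the inverse of w for the twisted product, so the image of k under
      \<open>s w\<close> is the conjugate z * k * w; invariance of K is normality of a
      kernel.\<close>
    define z where "z = map_prod (inv_into UNIV (s w)) (inv_into UNIV (s w)) (- w)"
    have z: "map_prod (s w) (s w) z = - w"
      by (cases w) (simp add: z_def surj_f_inv_f[OF bij_is_surj[OF bij]])
    have "s k \<circ> s z = s (z + k)"
      using mult[of k z] k by (simp add: K_def prod.map_id0)
    then have sz: "s (z + k) = s z"
      using k by (simp add: K_def)
    have "map_prod (s w) (s w) (z + k) + w = map_prod (s w) (s w) k"
      using z by (cases z; cases k; cases w) (simp add: add)
    then have "s (map_prod (s w) (s w) k) = s w \<circ> s z"
      using mult[of w "z + k"] sz by simp
    also have "\<dots> = id"
      using mult[of w z] z s_0 by simp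
    finally show ?thesis by (simp add: K_def)
  qed

  have fibre: "card {v. s v = s w} = card K" for w
  proof -
    \<comment> \<open>The fibres of s are the cosets K * w for the twisted product.\<close>
    have "{v. s v = s w} = (\<lambda>k. map_prod (s w) (s w) k + w) ` K"
    proof (intro equalityI subsetI)
      fix v assume v: "v \<in> {v. s v = s w}"
      define k where "k = map_prod (inv_into UNIV (s w)) (inv_into UNIV (s w)) (v - w)"
      have k: "v = map_prod (s w) (s w) k + w"
        by (cases v; cases w) (simp add: k_def surj_f_inv_f[OF bij_is_surj[OF bij]])
      then have "s w \<circ> s k = s w"
        using mult[of w k] v by simp
      then have "k \<in> K"
        using inj[of w] by (simp add: K_def fun_eq_iff inj_eq)
      then show "v \<in> (\<lambda>k. map_prod (s w) (s w) k + w) ` K"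
        using k by blast
    next
      fix v assume "v \<in> (\<lambda>k. map_prod (s w) (s w) k + w) ` K"
      then obtain k where "k \<in> K" "v = map_prod (s w) (s w) k + w" by blast
      then show "v \<in> {v. s v = s w}"
        using mult[of w k] by (simp add: K_def)
    qed
    moreover have "inj_on (\<lambda>k. map_prod (s w) (s w) k + w) K"
      using inj[of w] by (auto simp: inj_on_def)
    ultimately show ?thesis
      by (simp add: card_image)
  qed
  have card_V: "CARD('a \<times> 'a) = p ^ (2 * m)"
    by (simp add: card power_add mult_2)
  have "CARD('a \<times> 'a) = (\<Sum>\<tau>\<in>A. card {v. s v = \<tau>})"
    unfolding A_def using sum.image_gen[of UNIV "\<lambda>_. 1::nat" s] by simp
  also have "\<dots> = card A * card K"
  proof -
    have "card {v. s v = \<tau>} = card K" if "\<tau> \<in> A" for \<tau>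
      using that fibre unfolding A_def by blast
    then show ?thesis by simp
  qed
  finally have card_AK: "CARD('a \<times> 'a) = card A * card K" .
  then have "card A dvd p ^ (2 * m)"
    using card_V by (metis dvd_triv_left)
  then obtain r where r: "card A = p ^ r"
    using divides_primepow_nat[OF p] by blast

  obtain i where "\<sigma> = \<phi> ^^ i"
    using frob[of g] g by blast
  then have "\<sigma> ^^ m = id"
    using \<phi>_m by (simp add: funpow_mult mult.commute[of i]) (simp flip: funpow_mult)
  from order_eq_card_range_funpow[OF m this]
  have order: "\<sigma> ^^ (p ^ r) = id" "\<And>i. 0 < i \<Longrightarrow> i < p ^ r \<Longrightarrow> \<sigma> ^^ i \<noteq> id"
    unfolding A_eq[symmetric] r by auto

  \<comment> \<open>The n-th twisted power of g, in coordinates; s sends it to the n-th power of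
    \<open>\<sigma>\<close>.\<close>
  define u where "u n = ((\<Sum>i<n. (\<sigma> ^^ i) (fst g)), (\<Sum>i<n. (\<sigma> ^^ i) (snd g)))" for n
  have \<sigma>_add: "\<sigma> (x + y) = \<sigma> x + \<sigma> y" for x y
    using add[of g] g by simp
  have \<sigma>_sum: "\<sigma> (sum f I) = (\<Sum>i\<in>I. \<sigma> (f i))" for f :: "nat \<Rightarrow> 'a" and I
    using zero[of g] g by (induction I rule: infinite_finite_induct) (simp_all add: \<sigma>_add)
  have s_u: "s (u n) = \<sigma> ^^ n" for n
  proof (induction n)
    case 0
    then show ?case by (simp add: u_def s_0 flip: zero_prod_def)
  next
    case (Suc n)
    have "u (Suc n) = map_prod \<sigma> \<sigma> (u n) + g"
      unfolding u_def sum.lessThan_Suc_shift by (cases g) (simp add: \<sigma>_sum add.commute)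
    then show ?case
      using mult[of g "u n"] g Suc by simp
  qed
  define N where "N v = map_prod \<sigma> \<sigma> v - v" for v
  have N_pow: "(N ^^ j) v = (((\<lambda>x. \<sigma> x - x) ^^ j) (fst v), ((\<lambda>x. \<sigma> x - x) ^^ j) (snd v))" for j v
    by (induction j) (simp_all add: N_def)
  have u_N: "u (p ^ k) = (N ^^ (p ^ k - 1)) g" for k
    using sum_funpow_prime_power[of \<sigma> _ k, OF _ \<sigma>_add] p by (simp add: u_def N_pow CHAR)
  have N_diff: "N (x - y) = N x - N y" for x y
  proof -
    have "\<sigma> (a - b) = \<sigma> a - \<sigma> b" for a b
      using \<sigma>_add[of "a - b" b] by simp
    then show ?thesis
      by (cases x; cases y) (simp add: N_def)
  qed
  have N_K: "N k \<in> K" if "k \<in> K" for k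
    unfolding N_def using K_diff K_invariant[of k g] g that by simp

  have "p ^ (r - 1) \<le> r" if "r \<noteq> 0"
  proof -
    have p_gt: "p > 1"
      using p by (rule prime_gt_1_nat)
    have "\<sigma> ^^ (p ^ (r - 1)) \<noteq> id"
      using order(2)[of "p ^ (r - 1)"] p_gt that by simp
    then have "(N ^^ (p ^ (r - 1) - 1)) g \<notin> K"
      unfolding u_N[symmetric] by (simp add: K_def s_u)
    \<comment> \<open>This only ensures that the iterates of g reach K; the bound comes from D =
      p^(r-1) - 1, for which \<open>Suc D\<close> is p^(r-1).\<close>
    moreover have "(N ^^ (p ^ r - 1)) g \<in> K"
      unfolding u_N[symmetric] by (simp add: K_def s_u order(1))
    ultimately have "card K * p ^ Suc (p ^ (r - 1) - 1) \<le> CARD('a \<times> 'a)"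
      using p card_V K_0 K_diff N_diff N_K by (intro card_ge_if_funpow_notin)
    also have "\<dots> = card K * p ^ r"
      using card_AK r by (simp add: mult.commute)
    finally have "p ^ Suc (p ^ (r - 1) - 1) \<le> p ^ r"
      using K_0 by (auto simp: card_gt_0_iff)
    then show "p ^ (r - 1) \<le> r"
      using p_gt by simp
  qed
  moreover have "s v ^^ (p ^ r) = id" for v
  proof -
    have "s v \<in> range (\<lambda>i. \<sigma> ^^ i)"
      unfolding A_eq[symmetric] by (simp add: A_def)
    then obtain j where "s v = \<sigma> ^^ j" by blast
    then show ?thesis
      using order(1) by (simp add: funpow_mult mult.commute[of j]) (simp flip: funpow_mult)
  qed
  ultimately show ?thesis
    by (intro exI[of _ r] conjI) (cases "r = 0", simp_all)
qed

section \<open>From the plane group to the bounds on \<open>r_AB\<close>\<close>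

lemma perm_exponent_dvd:
  assumes "n > 0" and "\<And>\<sigma>. \<sigma> \<in> S \<Longrightarrow> \<sigma> ^^ n = id"
  shows "perm_exponent S dvd n"
proof -
  let ?P = "\<lambda>n. n > 0 \<and> (\<forall>\<sigma>\<in>S. \<sigma> ^^ n = id)"
  let ?e = "perm_exponent S"
  have e: "?P ?e"
    unfolding perm_exponent_def by (rule LeastI[of ?P n]) (use assms in simp)
  have "\<sigma> ^^ (n mod ?e) = id" if "\<sigma> \<in> S" for \<sigma>
    using e that assms(2)[OF that] by (intro ext) (simp add: funpow_mod_eq)
  moreover have "n mod ?e < ?e"
    using e by simp
  then have "\<not> ?P (n mod ?e)"
    unfolding perm_exponent_def by (rule not_less_Least)
  ultimately show ?thesis
    by (auto simp: dvd_eq_mod_eq_0)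
qed

text \<open>The bottom row of \<open>E a b c t\<close> is (a, b, c, 1), so the bottom row of a
  product identifies its parameters; with both third parameters 0, the values of T do not enter
  it.\<close>

lemma \<theta>_mult_G_AB:
  assumes aut: "\<And>a b c. \<theta> a b c \<in> field_aut"
    and closed: "\<And>g h. g \<in> G_set T \<theta> \<Longrightarrow> h \<in> G_set T \<theta> \<Longrightarrow> semilin_mult g h \<in> G_set T \<theta>"
  shows "\<theta> x y 0 \<circ> \<theta> a b 0 = \<theta> (\<theta> x y 0 a + x) (\<theta> x y 0 b + y) 0"
proof -
  let ?\<sigma> = "\<theta> x y 0"
  let ?M = "map_matrix ?\<sigma> (E a b 0 (T a b 0)) ** E x y 0 (T x y 0)"
  have \<sigma>: "?\<sigma> 0 = 0" "?\<sigma> 1 = 1"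
    using field_aut_0[OF aut] aut[of x y 0] by (auto simp: field_aut_def)
  have "semilin_mult (g_elem T \<theta> a b 0) (g_elem T \<theta> x y 0) \<in> G_set T \<theta>"
    by (rule closed) (auto simp: G_set_def)
  then obtain a' b' c' where eq: "?M = E a' b' c' (T a' b' c')" "?\<sigma> \<circ> \<theta> a b 0 = \<theta> a' b' c'"
    by (auto simp: G_set_def semilin_mult_def g_elem_def)
  have "?M $ 4 $ 1 = ?\<sigma> a + x" "?M $ 4 $ 2 = ?\<sigma> b + y" "?M $ 4 $ 3 = 0"
    by (simp_all add: matrix_matrix_mult_def map_matrix_def sum_4 E_def \<sigma>)
  moreover have "E a' b' c' (T a' b' c') $ 4 $ 1 = a'" "E a' b' c' (T a' b' c') $ 4 $ 2 = b'"
    "E a' b' c' (T a' b' c') $ 4 $ 3 = c'"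
    by (simp_all add: E_def)
  ultimately show ?thesis
    using eq by simp
qed

text \<open>The contrapositive turns p^(r-1) <= r into r <= 2, and into r <= 1 for p >= 3. The base
  cases are 3 < p^2 and 2 < p; each step at least doubles the right side.\<close>

lemma less_power_pred:
  fixes p r :: nat
  assumes "2 \<le> p" "3 \<le> r \<or> 3 \<le> p \<and> 2 \<le> r"
  shows "r < p ^ (r - 1)"
proof -
  have step: "k < p ^ (k - 1)" if "k0 \<le> k" "k0 < p ^ (k0 - 1)" "1 \<le> k0" for k k0
    using that
  proof (induction k rule: dec_induct)
    case (step k)
    then have "Suc k \<le> 2 * k" "k < p ^ (k - 1)" by auto
    moreover have "2 * p ^ (k - 1) \<le> p ^ k"
      using assms(1) step by (simp add: power_eq_if)
    ultimately show ?case by simp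
  qed simp
  show ?thesis
    using assms(2)
  proof
    assume "3 \<le> r"
    moreover have "2 ^ 2 \<le> p ^ 2"
      using assms(1) by (rule power_mono) simp
    ultimately show ?thesis
      using step[of 3 r] by simp
  next
    assume "3 \<le> p \<and> 2 \<le> r"
    then show ?thesis
      using step[of 2 r] by simp
  qed
qed

theorem theorem5p3:
  fixes p m :: nat
    and T :: "'a::{field, finite} \<Rightarrow> 'a \<Rightarrow> 'a \<Rightarrow> 'a"
    and \<theta> :: "'a \<Rightarrow> 'a \<Rightarrow> 'a \<Rightarrow> ('a \<Rightarrow> 'a)"
  assumes "prime p"
    and "CARD('a) = p ^ m"
    and "\<And>a b c. \<theta> a b c \<in> field_aut"
    and "\<And>g h. g \<in> G_set T \<theta> \<Longrightarrow> h \<in> G_set T \<theta> \<Longrightarrow> semilin_mult g h \<in> G_set T \<theta>"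
    and "\<exists>a b c. \<theta> a b c \<noteq> id"
  shows "(odd (CARD('a)) \<longrightarrow> r_AB p T \<theta> \<le> 1) \<and> (even (CARD('a)) \<longrightarrow> r_AB p T \<theta> \<le> 2)"
proof -
  have p_gt: "p > 1"
    using assms(1) by (rule prime_gt_1_nat)
  define s where "s v = \<theta> (fst v) (snd v) 0" for v
  have "s w \<circ> s v = s (map_prod (s w) (s w) v + w)" for v w
    using \<theta>_mult_G_AB[OF assms(3,4)] by (simp add: s_def)
  moreover have "s v \<in> field_aut" for v
    unfolding s_def by (rule assms(3))
  ultimately obtain r where r: "r = 0 \<or> p ^ (r - 1) \<le> r" "\<And>v. s v ^^ (p ^ r) = id"
    using twisted_plane_group_exponent[OF assms(1,2), of s] by blast
  have "\<tau> ^^ (p ^ r) = id" if "\<tau> \<in> \<psi> ` G_AB T \<theta>" for \<tau>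
    using that r(2) by (fastforce simp: G_AB_def s_def)
  then have "perm_exponent (\<psi> ` G_AB T \<theta>) dvd p ^ r"
    using p_gt by (intro perm_exponent_dvd) auto
  then obtain i where i: "i \<le> r" "perm_exponent (\<psi> ` G_AB T \<theta>) = p ^ i"
    using divides_primepow_nat[OF assms(1)] by blast
  \<comment> \<open>As p > 1, the exponent i is the only one, so the definite description is
    resolved.\<close>
  have "r_AB p T \<theta> = i"
    unfolding r_AB_def i(2) using p_gt by (intro the_equality) auto
  moreover have "r \<le> 2" and "p = 2 \<or> r \<le> 1"
    using less_power_pred[of p r] r(1) p_gt by force+
  \<comment> \<open>Read contrapositively: odd q excludes p = 2, leaving r <= 1.\<close>
  moreover have "even (CARD('a))" if "p = 2"
  proof -
    have "CHAR('a) = p"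
      using assms(1,2) by (rule CHAR_eq_if_card_prime_power)
    then show ?thesis
      using CHAR_dvd_CARD[where 'a = 'a] that by simp
  qed
  ultimately show ?thesis
    using i(1) by auto
qed

end
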